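(* Let $\Omega=(a,b)\subset\mathbb{R}$ be a bounded interval, let $G$ and $H$ be Young functions satisfying the $\Delta'$ condition, and let $w\in L^\infty(\Omega)$ be a non-negative weight function which is not a.e. zero. Let $\lambda_1=\lambda_{1,1}$ be the first eigenvalue (at energy level $1$) of $$-\left(g(|u'|)\frac{u'}{|u'|}\right)'=\lambda\, w(x)\,h(|u|)\frac{u}{|u|}\ \text{ in }(a,b),\qquad u(a)=u(b)=0,$$ where $g=G'$, $h=H'$. Then $$\left[G\left(2c\,\kappa_0\,(b-a)\,\frac{G^{-1}\left(\frac{1}{b-a}\right)}{H^{-1}\left(\|w\|_{L^1(\Omega)}^{-1}\right)}\right)\right]^{-1}\le\lambda_1,$$ where $\kappa_0=C^{p^+}$ and $C$, $c$, $p^+$ are the structural constants of $G$ and $H$ (the constant $C$ in the $\Delta'$ condition, the constant $c$ in the corresponding inequality for inverses, and the upper growth exponent $p^+$).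
   Context: Young functions. A Young function is a map $G:[0,\infty)\to[0,\infty)$ of the form $G(t)=\int_0^t g(s)\,ds$ with $g=G'$ right-continuous on $[0,\infty)$, $g(0)=0$, $g(t)>0$ for $t>0$, $g$ nondecreasing, and $\lim_{t\to\infty}g(t)=\infty$. The Young functions $G,H$ are normalized by $G(1)=H(1)=1$, have absolutely continuous derivatives, and satisfy, for constants $1\le p^-\le p^+<\infty$, $p^-\le \frac{tG'(t)}{G(t)}\le p^+$ for all $t>0$ (same for $H$). $\Delta'$ condition with constant $C\ge1$: $G(ab)\le C\,G(a)G(b)$ for all $a,b\ge0$. It implies that there is a constant $c$ (depending on $C,p^+,p^-$) with $G^{-1}(s)G^{-1}(t)\le c\,G^{-1}(st)$ for all $s,t\ge0$. The constants $C$, $c$, $p^\pm$ are fixed so that these inequalities hold for both $G$ and $H$. Spaces. $\|u\|_G=\inf\{\delta>0:\int_\Omega G(|u|/\delta)\,dx\le1\}$; $L^G(\Omega)$ is the set of measurable $u$ with $\int_\Omega G(|u|)\,dx<\infty$; $W^{1,G}(\Omega)=\{u\in L^G(\Omega):u'\in L^G(\Omega)\}$ and $W^{1,G}_0(\Omega)$ is the closure of $C_c^\infty(\Omega)$ in $W^{1,G}(\Omega)$ for the norm $\|u\|_G+\|u'\|_G$. First eigenvalue. For $\mu>0$ let $\mathcal{A}_\mu=\{u\in W_0^{1,G}(\Omega):\int_\Omega wH(|u|)\,dx=\mu\}$ and $$\lambda_{1,\mu}=\inf\left\{\frac{\int_\Omega G(|u'|)\,dx}{\int_\Omega wH(|u|)\,dx}: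 u\in\mathcal{A}_\mu\right\};\qquad \lambda_1:=\lambda_{1,1}.$$ *)

theory Defs
  imports "HOL-Analysis.Analysis"
begin

section \<open>Young functions\<close>

definition abs_cont_on :: "real set \<Rightarrow> (real \<Rightarrow> real) \<Rightarrow> bool" where
  "abs_cont_on S f \<longleftrightarrow>
     (\<forall>\<epsilon>>0. \<exists>\<delta>>0. \<forall>D. finite D \<longrightarrow>
        (\<forall>(x, y)\<in>D. x \<le> y \<and> {x..y} \<subseteq> S) \<longrightarrow>
        disjoint_family_on (\<lambda>(x, y). {x<..<y}) D \<longrightarrow>
        (\<Sum>(x, y)\<in>D. y - x) < \<delta> \<longrightarrow>
        (\<Sum>(x, y)\<in>D. \<bar>f y - f x\<bar>) < \<epsilon>)"

text \<open>A Young function lives on the half-line of non-negative reals; its values at negative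
  arguments are irrelevant. The function \<open>g\<close> is the derivative \<open>G'\<close>.\<close>

definition young_function :: "(real \<Rightarrow> real) \<Rightarrow> (real \<Rightarrow> real) \<Rightarrow> bool" where
  "young_function G g \<longleftrightarrow>
     (\<forall>t\<ge>0. (g has_integral G t) {0..t}) \<and>
     (\<forall>t\<ge>0. continuous (at_right t) g) \<and>
     g 0 = 0 \<and> (\<forall>t>0. g t > 0) \<and> mono_on {0..} g \<and> filterlim g at_top at_top"

text \<open>Absolute continuity of the derivative is meant on bounded intervals: already for
  \<open>G t = t ^ 3\<close> the derivative is not absolutely continuous on the whole half-line.\<close>

definition regular_young_function ::
  "real \<Rightarrow> real \<Rightarrow> (real \<Rightarrow> real) \<Rightarrow> (real \<Rightarrow> real) \<Rightarrow> bool" where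
  "regular_young_function pm pp G g \<longleftrightarrow>
     young_function G g \<and> G 1 = 1 \<and> (\<forall>T>0. abs_cont_on {0..T} g) \<and>
     (\<forall>t>0. pm \<le> t * g t / G t \<and> t * g t / G t \<le> pp)"

definition delta_prime :: "real \<Rightarrow> (real \<Rightarrow> real) \<Rightarrow> bool" where
  "delta_prime C G \<longleftrightarrow> (\<forall>s\<ge>0. \<forall>t\<ge>0. G (s * t) \<le> C * G s * G t)"

definition young_inv :: "(real \<Rightarrow> real) \<Rightarrow> real \<Rightarrow> real" where
  "young_inv G = the_inv_into {0..} G"

definition inverse_delta_prime :: "real \<Rightarrow> (real \<Rightarrow> real) \<Rightarrow> bool" where
  "inverse_delta_prime c G \<longleftrightarrow>
     (\<forall>s\<ge>0. \<forall>t\<ge>0. young_inv G s * young_inv G t \<le> c * young_inv G (s * t))"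

section \<open>Orlicz and Orlicz-Sobolev spaces\<close>

text \<open>Elements of the spaces are functions rather than classes modulo equality almost everywhere;
  their values outside \<open>\<Omega>\<close> are irrelevant.\<close>

definition orlicz_space :: "real set \<Rightarrow> (real \<Rightarrow> real) \<Rightarrow> (real \<Rightarrow> real) set" where
  "orlicz_space \<Omega> G =
     {u \<in> borel_measurable (lebesgue_on \<Omega>).
        (\<integral>\<^sup>+x. ennreal (G \<bar>u x\<bar>) \<partial>lebesgue_on \<Omega>) < \<infinity>}"

definition luxemburg_norm :: "real set \<Rightarrow> (real \<Rightarrow> real) \<Rightarrow> (real \<Rightarrow> real) \<Rightarrow> real" where
  "luxemburg_norm \<Omega> G u =
     Inf {\<delta>. \<delta> > 0 \<and> (\<integral>\<^sup>+x. ennreal (G (\<bar>u x\<bar> / \<delta>)) \<partial>lebesgue_on \<Omega>) \<le> 1}"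

text \<open>Smooth functions with compact support in \<open>\<Omega>\<close>, extended by zero to the real line.\<close>

definition test_functions :: "real set \<Rightarrow> (real \<Rightarrow> real) set" where
  "test_functions \<Omega> =
     {\<phi>. (\<forall>n x. (deriv ^^ n) \<phi> differentiable (at x)) \<and>
         compact (closure {x. \<phi> x \<noteq> 0}) \<and> closure {x. \<phi> x \<noteq> 0} \<subseteq> \<Omega>}"

definition locally_integrable_on :: "real set \<Rightarrow> (real \<Rightarrow> real) \<Rightarrow> bool" where
  "locally_integrable_on \<Omega> u \<longleftrightarrow>
     (\<forall>K. compact K \<longrightarrow> K \<subseteq> \<Omega> \<longrightarrow> u absolutely_integrable_on K)"

definition has_weak_deriv :: "real set \<Rightarrow> (real \<Rightarrow> real) \<Rightarrow> (real \<Rightarrow> real) \<Rightarrow> bool" where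
  "has_weak_deriv \<Omega> u v \<longleftrightarrow>
     locally_integrable_on \<Omega> u \<and> locally_integrable_on \<Omega> v \<and>
     (\<forall>\<phi>\<in>test_functions \<Omega>.
        (\<integral>x. u x * deriv \<phi> x \<partial>lebesgue_on \<Omega>) = - (\<integral>x. v x * \<phi> x \<partial>lebesgue_on \<Omega>))"

text \<open>On an open set weak derivatives are unique up to null sets, and everything below is invariant
  under changes on null sets, so the choice of representative does not matter.\<close>

definition weak_deriv :: "real set \<Rightarrow> (real \<Rightarrow> real) \<Rightarrow> real \<Rightarrow> real" where
  "weak_deriv \<Omega> u = (SOME v. has_weak_deriv \<Omega> u v)"

definition sobolev_space :: "real set \<Rightarrow> (real \<Rightarrow> real) \<Rightarrow> (real \<Rightarrow> real) set" where
  "sobolev_space \<Omega> G =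
     {u \<in> orlicz_space \<Omega> G. (\<exists>v. has_weak_deriv \<Omega> u v) \<and> weak_deriv \<Omega> u \<in> orlicz_space \<Omega> G}"

definition sobolev_space_0 :: "real set \<Rightarrow> (real \<Rightarrow> real) \<Rightarrow> (real \<Rightarrow> real) set" where
  "sobolev_space_0 \<Omega> G =
     {u \<in> sobolev_space \<Omega> G. \<forall>\<epsilon>>0. \<exists>\<phi>\<in>test_functions \<Omega>.
        luxemburg_norm \<Omega> G (\<lambda>x. u x - \<phi> x) +
        luxemburg_norm \<Omega> G (\<lambda>x. weak_deriv \<Omega> u x - deriv \<phi> x) < \<epsilon>}"

section \<open>The first eigenvalue\<close>

text \<open>For \<open>\<mu> > 0\<close> the energy constraint forces the integrand to be integrable, since the Bochner
  integral of a non-integrable function is zero.\<close>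

definition admissible ::
  "real set \<Rightarrow> (real \<Rightarrow> real) \<Rightarrow> (real \<Rightarrow> real) \<Rightarrow> (real \<Rightarrow> real) \<Rightarrow> real \<Rightarrow> (real \<Rightarrow> real) set" where
  "admissible \<Omega> G H w \<mu> =
     {u \<in> sobolev_space_0 \<Omega> G. (\<integral>x. w x * H \<bar>u x\<bar> \<partial>lebesgue_on \<Omega>) = \<mu>}"

text \<open>The infimum is taken in the extended reals, so no separate convention is needed for an empty
  admissible set.\<close>

definition first_eigenvalue ::
  "real set \<Rightarrow> (real \<Rightarrow> real) \<Rightarrow> (real \<Rightarrow> real) \<Rightarrow> (real \<Rightarrow> real) \<Rightarrow> real \<Rightarrow> ereal" where
  "first_eigenvalue \<Omega> G H w \<mu> =
     (INF u\<in>admissible \<Omega> G H w \<mu>.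
        ereal ((\<integral>x. G \<bar>weak_deriv \<Omega> u x\<bar> \<partial>lebesgue_on \<Omega>) /
               (\<integral>x. w x * H \<bar>u x\<bar> \<partial>lebesgue_on \<Omega>)))"

end

theory Submission
  imports Defs
begin

text \<open>Let \<open>u\<close> be admissible, let \<open>u'\<close> be its weak derivative and \<open>L = b - a\<close>. Approximation by test
  functions gives \<open>\<bar>u\<bar> \<le> A\<close> almost everywhere, where \<open>A\<close> is the \<open>L\<^sup>1\<close> norm of \<open>u'\<close>, so the
  constraint forces \<open>1 \<le> H A * \<parallel>w\<parallel>\<close>. By Jensen's inequality \<open>A / L \<le> G\<^sup>-\<^sup>1 (\<lambda> / L)\<close>, where \<open>\<lambda>\<close> is
  the energy of \<open>u\<close>. The condition on inverses, applied to the product of \<open>1 / \<lambda>\<close> and \<open>\<lambda> / L\<close>,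
  bounds \<open>G\<^sup>-\<^sup>1 (1 / \<lambda>)\<close> from above, hence \<open>\<lambda>\<close> from below.\<close>

section \<open>Young functions\<close>

lemma young_function_zero:
  assumes "young_function G g"
  shows "G 0 = 0"
proof -
  have "(g has_integral G 0) {0..0}"
    using assms unfolding young_function_def by blast
  then show ?thesis
    using has_integral_unique[OF _ has_integral_refl(2)[of g 0]] by simp
qed

lemma young_function_deriv_nonneg:
  assumes "young_function G g" "0 \<le> t"
  shows "0 \<le> g t"
  using assms unfolding young_function_def by (cases "t = 0") (auto intro: less_imp_le)

text \<open>Convexity in tangent form: \<open>g\<close> is nondecreasing, so its integral between
  \<open>m\<close> and \<open>t\<close> is compared with the constant \<open>g m\<close>.
  Monotonicity, linear growth and Jensen's inequality all come from choices of \<open>m\<close> and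
  \<open>t\<close>.\<close>

lemma young_function_tangent:
  assumes Y: "young_function G g" and "0 \<le> m" "0 \<le> t"
  shows "G m + g m * (t - m) \<le> G t"
proof -
  have int: "(g has_integral G s) {0..s}" if "0 \<le> s" for s
    using Y that unfolding young_function_def by blast
  have mono: "g x \<le> g y" if "0 \<le> x" "x \<le> y" for x y
    using Y that unfolding young_function_def mono_on_def by auto
  have diff: "(g has_integral (G y - G x)) {x..y}" if "0 \<le> x" "x \<le> y" for x y
  proof -
    have "g integrable_on {x..y}"
      using int[of y] that by (auto intro: integrable_on_subinterval)
    then obtain I where I: "(g has_integral I) {x..y}" by blast
    have "(g has_integral (G x + I)) {0..y}"
      using has_integral_combine[OF that int[OF that(1)] I] .
    then have "G x + I = G y" using int[of y] that by (auto intro: has_integral_unique)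
    then have "I = G y - G x" by simp
    then show ?thesis using I by simp
  qed
  show ?thesis
  proof (cases "m \<le> t")
    case True
    have "((\<lambda>x. g m) has_integral (g m * (t - m))) {m..t}"
      using has_integral_const_real[of "g m" m t] True by (simp add: mult.commute)
    from has_integral_le[OF this diff[OF assms(2) True]] mono assms show ?thesis by auto
  next
    case False
    then have tm: "t \<le> m" by simp
    have "((\<lambda>x. g m) has_integral (g m * (m - t))) {t..m}"
      using has_integral_const_real[of "g m" t m] tm by (simp add: mult.commute)
    from has_integral_le[OF diff[OF assms(3) tm] this] mono assms
    have "G m - G t \<le> g m * (m - t)" by auto
    then show ?thesis by (simp add: algebra_simps)
  qed
qed

lemma young_function_strict_mono:
  assumes Y: "young_function G g" and st: "0 \<le> s" "s < t"
  shows "G s < G t"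
proof -
  \<comment> \<open>The tangent at \<open>s\<close> has positive slope only for
    \<open>s > 0\<close>. When \<open>s\<close> may be zero, the midpoint of \<open>s\<close> and
    \<open>t\<close> serves as a positive intermediate point.\<close>
  have step: "G s < G t" if "0 < s" "s < t" for s t
  proof -
    have "0 < g s" using Y that unfolding young_function_def by blast
    then have "0 < g s * (t - s)" using that by simp
    then show ?thesis using young_function_tangent[OF Y, of s t] that by linarith
  qed
  have "0 \<le> g s * ((s + t) / 2 - s)"
    using young_function_deriv_nonneg[OF Y, of s] st by (intro mult_nonneg_nonneg) auto
  then have "G s \<le> G ((s + t) / 2)"
    using young_function_tangent[OF Y st(1), of "(s + t) / 2"] st by simp
  also have "\<dots> < G t" using step[of "(s + t) / 2" t] st by simp
  finally show ?thesis .
qed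

lemma young_function_mono:
  assumes "young_function G g" "0 \<le> s" "s \<le> t"
  shows "G s \<le> G t"
  using young_function_strict_mono[OF assms(1,2), of t] assms(3) by (cases "s = t") auto

lemma young_function_nonneg:
  assumes "young_function G g" "0 \<le> t"
  shows "0 \<le> G t"
  using young_function_mono[OF assms(1), of 0 t] young_function_zero[OF assms(1)] assms(2) by simp

lemma young_function_pos:
  assumes "young_function G g" "0 < t"
  shows "0 < G t"
  using young_function_strict_mono[OF assms(1), of 0 t] young_function_zero[OF assms(1)] assms(2)
  by simp

text \<open>Convexity together with \<open>G 0 = 0\<close>: the tangent at \<open>t / d\<close> is
  evaluated once at \<open>0\<close> and once at \<open>t\<close>.\<close>

lemma young_function_divide_le:
  assumes Y: "young_function G g" and "0 \<le> t" "1 \<le> d"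
  shows "G (t / d) \<le> G t / d"
proof -
  define m where "m = t / d"
  have t: "t = d * m" and m: "0 \<le> m" using assms by (auto simp: m_def)
  have 1: "G m \<le> g m * m"
    using young_function_tangent[OF Y m, of 0] young_function_zero[OF Y] by simp
  have "(d - 1) * G m \<le> (d - 1) * (g m * m)" using 1 assms by (intro mult_left_mono) auto
  also have "\<dots> = g m * (t - m)" by (simp add: t algebra_simps)
  also have "\<dots> \<le> G t - G m" using young_function_tangent[OF Y m assms(2)] by simp
  finally have "d * G m \<le> G t" by (simp add: algebra_simps)
  then show ?thesis using assms by (simp add: m_def field_simps)
qed

text \<open>This is the tangent at \<open>1\<close>. It yields surjectivity of \<open>G\<close> and,
  on sets of finite measure, the passage from Orlicz to L^1 bounds.\<close>

lemma young_function_linear_growth: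
  assumes Y: "young_function G g" and "0 \<le> t"
  shows "g 1 * t \<le> G t + g 1"
  using young_function_tangent[OF Y, of 1 t] young_function_nonneg[OF Y, of 1] assms(2)
  by (simp add: algebra_simps)

lemma young_function_continuous_on:
  assumes Y: "young_function G g"
  shows "continuous_on {0..} G"
proof -
  have cont: "continuous_on {0..t} G" if "0 \<le> t" for t
  proof -
    have int: "(g has_integral G s) {0..s}" if "0 \<le> s" for s
      using Y that unfolding young_function_def by blast
    have "continuous_on {0..t} (\<lambda>s. integral {0..s} g)"
      using int[OF that] by (intro indefinite_integral_continuous_1) blast
    then show ?thesis
      by (rule continuous_on_eq) (use int in \<open>auto intro: integral_unique\<close>)
  qed
  show ?thesis unfolding continuous_on_eq_continuous_within
  proof
    fix x :: real assume x: "x \<in> {0..}"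
    have "continuous (at x within {0..x+1}) G"
      using cont[of "x+1"] x
      by (auto simp: continuous_on_eq_continuous_within)
    \<comment> \<open>Near \<open>x\<close> the half-line agrees with a compact interval, where
      \<open>G\<close> is an indefinite integral and hence continuous.\<close>
    moreover have "at x within {0..} = at x within {0..x+1}"
      by (rule at_within_nhd[of _ "{..<x+1}"]) auto
    ultimately show "continuous (at x within {0..}) G" by simp
  qed
qed

lemma young_function_bij_betw:
  assumes Y: "young_function G g"
  shows "bij_betw G {0..} {0..}"
proof (rule bij_betw_imageI)
  show "inj_on G {0..}"
    using young_function_strict_mono[OF Y]
    by (intro strict_mono_on_imp_inj_on) (auto simp: strict_mono_on_def)
  have "y \<in> G ` {0..}" if y: "0 \<le> y" for y
  proof -
    have g1: "0 < g 1" using Y unfolding young_function_def by simp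
    \<comment> \<open>Chosen so that \<open>g 1 * t - g 1 = y\<close>; linear growth then gives
      \<open>y\<close> \<le> \<open>G t\<close>, the upper value for the intermediate value
      theorem.\<close>
    define t where "t = y / g 1 + 1"
    have t: "0 \<le> t" using g1 that by (simp add: t_def)
    have "y \<le> G t"
      using young_function_linear_growth[OF Y t] g1 by (simp add: t_def algebra_simps)
    moreover have "continuous_on {0..t} G"
      using young_function_continuous_on[OF Y] by (rule continuous_on_subset) auto
    ultimately obtain x where "0 \<le> x" "G x = y"
      using IVT'[of G 0 y t] t y young_function_zero[OF Y] by metis
    then show ?thesis by auto
  qed
  then show "G ` {0..} = {0..}" using young_function_nonneg[OF Y] by auto
qed

lemma young_inv_nonneg:
  assumes "young_function G g" "0 \<le> y"
  shows "0 \<le> young_inv G y"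
  using the_inv_into_into[of G "{0..}" y "{0..}"] young_function_bij_betw[OF assms(1)] assms(2)
  by (auto simp: young_inv_def bij_betw_def)

lemma young_inv_right:
  assumes "young_function G g" "0 \<le> y"
  shows "G (young_inv G y) = y"
  using f_the_inv_into_f_bij_betw[OF young_function_bij_betw[OF assms(1)]] assms(2)
  by (simp add: young_inv_def)

lemma le_young_inv_iff:
  assumes Y: "young_function G g" and "0 \<le> t" "0 \<le> y"
  shows "t \<le> young_inv G y \<longleftrightarrow> G t \<le> y"
  using young_function_mono[OF Y assms(2), of "young_inv G y"]
    young_function_strict_mono[OF Y, of "young_inv G y" t]
    young_inv_right[OF Y assms(3)] young_inv_nonneg[OF Y assms(3)]
  by fastforce

lemma young_inv_pos:
  assumes Y: "young_function G g" and "0 < y"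
  shows "0 < young_inv G y"
  using young_inv_nonneg[OF Y, of y] young_inv_right[OF Y, of y] young_function_zero[OF Y] assms(2)
  by (cases "young_inv G y = 0") auto

section \<open>Orlicz spaces over sets of finite measure\<close>

text \<open>Values of \<open>G\<close> at negative arguments are arbitrary, so measurability is
  derived for the composition with the absolute value, which is continuous on the whole
  line.\<close>

lemma young_function_abs_measurable:
  assumes "young_function G g"
  shows "(\<lambda>x. G \<bar>x\<bar>) \<in> borel_measurable borel"
  by (intro borel_measurable_continuous_onI continuous_on_compose2[OF young_function_continuous_on[OF assms]]
      continuous_intros) auto

lemma young_function_comp_measurable:
  assumes "young_function G g" "f \<in> borel_measurable M"
  shows "(\<lambda>x. G \<bar>f x\<bar>) \<in> borel_measurable M"
  using measurable_compose[OF assms(2) young_function_abs_measurable[OF assms(1)]] .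

lemma orlicz_space_integrable:
  assumes Y: "young_function G g" and f: "f \<in> orlicz_space \<Omega> G"
  shows "integrable (lebesgue_on \<Omega>) (\<lambda>x. G \<bar>f x\<bar>)"
  using f young_function_nonneg[OF Y]
  by (intro integrableI_nonneg young_function_comp_measurable[OF Y])
    (auto simp: orlicz_space_def)

lemma orlicz_space_integrable_self:
  assumes Y: "young_function G g" and fin: "\<Omega> \<in> lmeasurable" and f: "f \<in> orlicz_space \<Omega> G"
  shows "integrable (lebesgue_on \<Omega>) f"
proof (rule Bochner_Integration.integrable_bound)
  interpret finite_measure "lebesgue_on \<Omega>" using fin by (rule finite_measure_lebesgue_on)
  \<comment> \<open>The dominating function comes from linear growth; its constant part is
    integrable because the measure is finite.\<close>
  show "integrable (lebesgue_on \<Omega>) (\<lambda>x. (G \<bar>f x\<bar> + g 1) / g 1)"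
    using orlicz_space_integrable[OF Y f] by simp
  show "f \<in> borel_measurable (lebesgue_on \<Omega>)" using f by (simp add: orlicz_space_def)
  have "0 < g 1" using Y unfolding young_function_def by simp
  then have "\<bar>f x\<bar> \<le> (G \<bar>f x\<bar> + g 1) / g 1" for x
    using young_function_linear_growth[OF Y, of "\<bar>f x\<bar>"] by (simp add: field_simps)
  then show "AE x in lebesgue_on \<Omega>. norm (f x) \<le> norm ((G \<bar>f x\<bar> + g 1) / g 1)"
    unfolding real_norm_def by (intro AE_I2 order_trans[OF _ abs_ge_self])
qed

text \<open>The tangent inequality at the mean \<open>m\<close> of the absolute value of
  \<open>f\<close> is integrated; the linear term has integral zero.\<close>

lemma jensen_young_function:
  assumes Y: "young_function G g" and fin: "\<Omega> \<in> lmeasurable" and pos: "0 < measure lebesgue \<Omega>"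
    and f: "f \<in> orlicz_space \<Omega> G"
  shows "measure lebesgue \<Omega> * G ((\<integral>x. \<bar>f x\<bar> \<partial>lebesgue_on \<Omega>) / measure lebesgue \<Omega>)
    \<le> (\<integral>x. G \<bar>f x\<bar> \<partial>lebesgue_on \<Omega>)"
proof -
  interpret finite_measure "lebesgue_on \<Omega>" using fin by (rule finite_measure_lebesgue_on)
  let ?M = "lebesgue_on \<Omega>" and ?L = "measure lebesgue \<Omega>"
  define m where "m = (\<integral>x. \<bar>f x\<bar> \<partial>?M) / ?L"
  have m: "0 \<le> m" by (simp add: m_def)
  have L: "measure ?M (space ?M) = ?L"
    using fin by (simp add: measure_restrict_space fmeasurableD)
  have fi: "integrable ?M (\<lambda>x. \<bar>f x\<bar>)"
    using orlicz_space_integrable_self[OF Y fin f] by simp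
  have "(\<integral>x. G m + g m * (\<bar>f x\<bar> - m) \<partial>?M) \<le> (\<integral>x. G \<bar>f x\<bar> \<partial>?M)"
    using fi orlicz_space_integrable[OF Y f] young_function_tangent[OF Y m]
    by (intro integral_mono) auto
  moreover have "(\<integral>x. G m + g m * (\<bar>f x\<bar> - m) \<partial>?M) = ?L * G m"
    using fi L pos by (simp add: m_def algebra_simps)
  ultimately show ?thesis by (simp add: m_def)
qed

text \<open>Puts the differences with a test function and its derivative into the Orlicz space,
  where the Luxemburg norm controls them. The condition \<open>delta_prime\<close> with first factor
  \<open>2\<close> acts as a doubling condition, and a bounded function contributes a
  constant.\<close>

lemma orlicz_space_diff_bounded:
  assumes Y: "young_function G g" and D: "delta_prime C G" and fin: "\<Omega> \<in> lmeasurable"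
    and f: "f \<in> orlicz_space \<Omega> G" and \<phi>: "\<phi> \<in> borel_measurable (lebesgue_on \<Omega>)"
    and B: "\<And>x. x \<in> \<Omega> \<Longrightarrow> \<bar>\<phi> x\<bar> \<le> B"
  shows "(\<lambda>x. f x - \<phi> x) \<in> orlicz_space \<Omega> G"
proof -
  interpret finite_measure "lebesgue_on \<Omega>" using fin by (rule finite_measure_lebesgue_on)
  have fm: "f \<in> borel_measurable (lebesgue_on \<Omega>)" using f by (simp add: orlicz_space_def)
  have bound: "G \<bar>f x - \<phi> x\<bar> \<le> C * G 2 * G \<bar>f x\<bar> + G (2 * \<bar>B\<bar>)" if "x \<in> \<Omega>" for x
  proof -
    have D': "G (2 * \<bar>f x\<bar>) \<le> C * G 2 * G \<bar>f x\<bar>" using D unfolding delta_prime_def by auto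
    have nn: "0 \<le> G (2 * \<bar>f x\<bar>)" "0 \<le> G (2 * \<bar>B\<bar>)" using young_function_nonneg[OF Y] by auto
    have "\<bar>f x - \<phi> x\<bar> \<le> \<bar>f x\<bar> + \<bar>B\<bar>" using B[OF that] by linarith
    \<comment> \<open>A sum is at most twice its larger term, so the monotone \<open>G\<close> is
      bounded by the sum of its values at the two doubled terms.\<close>
    also have "\<dots> \<le> max (2 * \<bar>f x\<bar>) (2 * \<bar>B\<bar>)" by linarith
    finally have "G \<bar>f x - \<phi> x\<bar> \<le> G (max (2 * \<bar>f x\<bar>) (2 * \<bar>B\<bar>))"
      by (intro young_function_mono[OF Y]) auto
    then show ?thesis using D' nn by (auto simp: max_def split: if_splits)
  qed
  have "integrable (lebesgue_on \<Omega>) (\<lambda>x. G \<bar>f x - \<phi> x\<bar>)"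
  proof (rule Bochner_Integration.integrable_bound)
    show "integrable (lebesgue_on \<Omega>) (\<lambda>x. C * G 2 * G \<bar>f x\<bar> + G (2 * \<bar>B\<bar>))"
      using orlicz_space_integrable[OF Y f] by simp
    show "(\<lambda>x. G \<bar>f x - \<phi> x\<bar>) \<in> borel_measurable (lebesgue_on \<Omega>)"
      using fm \<phi> by (intro young_function_comp_measurable[OF Y]) auto
    show "AE x in lebesgue_on \<Omega>. norm (G \<bar>f x - \<phi> x\<bar>)
        \<le> norm (C * G 2 * G \<bar>f x\<bar> + G (2 * \<bar>B\<bar>))"
      using bound young_function_nonneg[OF Y]
      by (intro AE_I2) (auto simp: abs_of_nonneg intro!: order_trans[OF _ abs_ge_self])
  qed
  then have "(\<integral>\<^sup>+x. ennreal (G \<bar>f x - \<phi> x\<bar>) \<partial>lebesgue_on \<Omega>) < \<infinity>"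
    using young_function_nonneg[OF Y] by (subst nn_integral_eq_integral) auto
  then show ?thesis using fm \<phi> by (auto simp: orlicz_space_def)
qed

text \<open>Without this lemma the infimum defining the norm could be that of the empty set, which is
  an unspecified real number.\<close>

lemma luxemburg_norm_set_nonempty:
  assumes Y: "young_function G g" and f: "f \<in> orlicz_space \<Omega> G"
  shows "{\<delta>. \<delta> > 0 \<and> (\<integral>\<^sup>+x. ennreal (G (\<bar>f x\<bar> / \<delta>)) \<partial>lebesgue_on \<Omega>) \<le> 1} \<noteq> {}"
proof -
  let ?M = "lebesgue_on \<Omega>"
  \<comment> \<open>Being at least \<open>1\<close> lets \<open>young_function_divide_le\<close>
    apply; being at least the integral makes the quotient at most \<open>1\<close>.\<close>
  define d where "d = max 1 (\<integral>x. G \<bar>f x\<bar> \<partial>?M)"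
  have d: "1 \<le> d" by (simp add: d_def)
  have i: "integrable ?M (\<lambda>x. G \<bar>f x\<bar> / d)" using orlicz_space_integrable[OF Y f] by simp
  have "(\<integral>\<^sup>+x. ennreal (G (\<bar>f x\<bar> / d)) \<partial>?M) \<le> (\<integral>\<^sup>+x. ennreal (G \<bar>f x\<bar> / d) \<partial>?M)"
    using young_function_divide_le[OF Y _ d] by (intro nn_integral_mono ennreal_leI) auto
  also have "\<dots> = ennreal ((\<integral>x. G \<bar>f x\<bar> \<partial>?M) / d)"
    using i young_function_nonneg[OF Y] d by (subst nn_integral_eq_integral) auto
  also have "\<dots> \<le> ennreal 1" using d by (intro ennreal_leI) (auto simp: d_def)
  finally have "(\<integral>\<^sup>+x. ennreal (G (\<bar>f x\<bar> / d)) \<partial>?M) \<le> 1" by simp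
  then show ?thesis using d by (auto intro!: exI[of _ d])
qed

lemma luxemburg_norm_nonneg:
  assumes "young_function G g" "f \<in> orlicz_space \<Omega> G"
  shows "0 \<le> luxemburg_norm \<Omega> G f"
  unfolding luxemburg_norm_def
  by (rule cInf_greatest[OF luxemburg_norm_set_nonempty[OF assms]]) auto

text \<open>Linear growth is applied to \<open>f\<close> divided by a feasible \<open>d\<close>
  below \<epsilon>: the modular of the quotient is at most \<open>1\<close>, and rescaling by
  \<open>d\<close> gives the L^1 bound.\<close>

lemma integral_abs_le_luxemburg_norm:
  assumes Y: "young_function G g" and fin: "\<Omega> \<in> lmeasurable" and f: "f \<in> orlicz_space \<Omega> G"
    and less: "luxemburg_norm \<Omega> G f < \<epsilon>"
  shows "(\<integral>x. \<bar>f x\<bar> \<partial>lebesgue_on \<Omega>) \<le> \<epsilon> * (1 / g 1 + measure lebesgue \<Omega>)"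
proof -
  interpret finite_measure "lebesgue_on \<Omega>" using fin by (rule finite_measure_lebesgue_on)
  let ?M = "lebesgue_on \<Omega>" and ?L = "measure lebesgue \<Omega>"
  have g1: "0 < g 1" using Y unfolding young_function_def by simp
  \<comment> \<open>The strict inequality for the infimum provides an actual element of the set, so
    attainment is not an issue.\<close>
  obtain d where d: "0 < d" "d < \<epsilon>" and le: "(\<integral>\<^sup>+x. ennreal (G (\<bar>f x\<bar> / d)) \<partial>?M) \<le> 1"
    using less cInf_lessD[OF luxemburg_norm_set_nonempty[OF Y f]] unfolding luxemburg_norm_def
    by blast
  have L: "measure ?M (space ?M) = ?L"
    using fin by (simp add: measure_restrict_space fmeasurableD)
  have fm: "f \<in> borel_measurable ?M" using f by (simp add: orlicz_space_def)
  have abs: "\<bar>f x / d\<bar> = \<bar>f x\<bar> / d" for x using d by simp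
  have fd: "(\<lambda>x. f x / d) \<in> orlicz_space \<Omega> G"
    using fm le_less_trans[OF le, of \<infinity>] unfolding orlicz_space_def mem_Collect_eq abs by auto
  have i: "integrable ?M (\<lambda>x. G (\<bar>f x\<bar> / d))"
    using orlicz_space_integrable[OF Y fd] unfolding abs .
  have "ennreal (\<integral>x. G (\<bar>f x\<bar> / d) \<partial>?M) \<le> 1"
    using le i young_function_nonneg[OF Y] d by (subst (asm) nn_integral_eq_integral) auto
  then have I: "(\<integral>x. G (\<bar>f x\<bar> / d) \<partial>?M) \<le> 1" by simp
  have fi: "integrable ?M (\<lambda>x. \<bar>f x\<bar>)"
    using orlicz_space_integrable_self[OF Y fin f] by simp
  have "(\<integral>x. \<bar>f x\<bar> \<partial>?M) \<le> (\<integral>x. d / g 1 * (G (\<bar>f x\<bar> / d) + g 1) \<partial>?M)"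
  proof (rule integral_mono)
    show "\<bar>f x\<bar> \<le> d / g 1 * (G (\<bar>f x\<bar> / d) + g 1)" for x
      using young_function_linear_growth[OF Y, of "\<bar>f x\<bar> / d"] d g1 by (simp add: field_simps)
  qed (use i fi in auto)
  also have "\<dots> = d * ((\<integral>x. G (\<bar>f x\<bar> / d) \<partial>?M) / g 1 + ?L)"
    using i g1 L by (simp add: field_simps)
  also have "\<dots> \<le> \<epsilon> * (1 / g 1 + ?L)"
    using d I g1 by (intro mult_mono add_mono divide_right_mono add_nonneg_nonneg)
      (auto intro: Bochner_Integration.integral_nonneg simp: young_function_nonneg[OF Y])
  finally show ?thesis .
qed

section \<open>The Sobolev bound on an interval\<close>

lemma test_function_has_real_derivative:
  assumes "\<phi> \<in> test_functions \<Omega>"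
  shows "(\<phi> has_real_derivative deriv \<phi> x) (at x)"
proof -
  have "(deriv ^^ 0) \<phi> differentiable (at x)" using assms unfolding test_functions_def by blast
  then show ?thesis using DERIV_deriv_iff_real_differentiable by simp
qed

lemma test_function_deriv_continuous_on:
  assumes "\<phi> \<in> test_functions \<Omega>"
  shows "continuous_on S (deriv \<phi>)"
proof -
  have "(deriv ^^ 1) \<phi> differentiable (at x)" for x
    using assms unfolding test_functions_def by blast
  then show ?thesis
    by (intro continuous_at_imp_continuous_on ballI differentiable_imp_continuous_within) simp
qed

lemma test_function_continuous_on:
  assumes "\<phi> \<in> test_functions \<Omega>"
  shows "continuous_on S \<phi>"
  using DERIV_isCont[OF test_function_has_real_derivative[OF assms]]
  by (intro continuous_at_imp_continuous_on) auto

lemma continuous_on_bounded_interval: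
  fixes f :: "real \<Rightarrow> real"
  assumes "continuous_on {a..b} f"
  obtains B where "\<And>x. x \<in> {a<..<b} \<Longrightarrow> \<bar>f x\<bar> \<le> B"
proof -
  have "bounded (f ` {a..b})" using assms by (intro compact_imp_bounded compact_continuous_image) auto
  then obtain B where "\<forall>y\<in>f ` {a..b}. norm y \<le> B" by (auto simp: bounded_iff)
  then show ?thesis by (intro that[of B]) auto
qed

lemma continuous_on_measurable_lebesgue_on:
  fixes f :: "real \<Rightarrow> real"
  assumes "continuous_on {a<..<b} f"
  shows "f \<in> borel_measurable (lebesgue_on {a<..<b})"
  using assms by (intro continuous_imp_measurable_on_sets_lebesgue) auto

text \<open>The support is a subset of the open interval, so \<phi> vanishes at \<open>a\<close>,
  and the fundamental theorem of calculus is applied from \<open>a\<close> to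
  \<open>x\<close>.\<close>

lemma test_function_abs_le_integral_deriv:
  assumes \<phi>: "\<phi> \<in> test_functions {a<..<b}" and x: "x \<in> {a<..<b}"
  shows "\<bar>\<phi> x\<bar> \<le> (\<integral>x. \<bar>deriv \<phi> x\<bar> \<partial>lebesgue_on {a<..<b})"
proof -
  have cont: "continuous_on {s..t} (\<lambda>x. \<bar>deriv \<phi> x\<bar>)" for s t
    using test_function_deriv_continuous_on[OF \<phi>] by (intro continuous_intros)
  have "closure {x. \<phi> x \<noteq> 0} \<subseteq> {a<..<b}" using \<phi> unfolding test_functions_def by blast
  then have a0: "\<phi> a = 0" using closure_subset[of "{x. \<phi> x \<noteq> 0}"] by fastforce
  have ftc: "(deriv \<phi> has_integral (\<phi> x - \<phi> a)) {a..x}"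
    using x test_function_has_real_derivative[OF \<phi>]
    by (intro fundamental_theorem_of_calculus)
      (auto simp: has_real_derivative_iff_has_vector_derivative[symmetric]
        intro: has_field_derivative_at_within)
  have "\<bar>\<phi> x\<bar> = norm (integral {a..x} (deriv \<phi>))" using integral_unique[OF ftc] a0 by simp
  also have "\<dots> \<le> integral {a..x} (\<lambda>x. \<bar>deriv \<phi> x\<bar>)"
    using cont test_function_deriv_continuous_on[OF \<phi>]
    by (intro integral_norm_bound_integral integrable_continuous_real) auto
  also have "\<dots> \<le> integral {a..b} (\<lambda>x. \<bar>deriv \<phi> x\<bar>)"
    using x cont by (intro integral_subset_le integrable_continuous_real) auto
  also have "\<dots> = integral {a<..<b} (\<lambda>x. \<bar>deriv \<phi> x\<bar>)" by (rule integral_open_interval_real)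
  also have "\<dots> = (\<integral>x. \<bar>deriv \<phi> x\<bar> \<partial>lebesgue_on {a<..<b})"
  proof (rule lebesgue_integral_eq_integral[symmetric])
    have "(\<lambda>x. \<bar>deriv \<phi> x\<bar>) absolutely_integrable_on {a..b}"
      using cont by (rule absolutely_integrable_continuous_real)
    then have "(\<lambda>x. \<bar>deriv \<phi> x\<bar>) absolutely_integrable_on {a<..<b}"
      by (rule set_integrable_subset) auto
    then show "integrable (lebesgue_on {a<..<b}) (\<lambda>x. \<bar>deriv \<phi> x\<bar>)"
      by (simp add: integrable_restrict_space set_integrable_def)
  qed simp
  finally show ?thesis .
qed

text \<open>The pointwise bound for test functions passes to \<open>u\<close> by comparing integrals
  of the excess over the bound, which avoids extracting an almost everywhere convergent
  subsequence.\<close>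

lemma sobolev_space_0_AE_bound:
  assumes Y: "young_function G g" and D: "delta_prime C G" and ab: "a < b"
    and u: "u \<in> sobolev_space_0 {a<..<b} G"
  shows "AE x in lebesgue_on {a<..<b}.
    \<bar>u x\<bar> \<le> (\<integral>x. \<bar>weak_deriv {a<..<b} u x\<bar> \<partial>lebesgue_on {a<..<b})"
proof -
  let ?\<Omega> = "{a<..<b}"
  let ?M = "lebesgue_on ?\<Omega>"
  define v where "v = weak_deriv ?\<Omega> u"
  define A where "A = (\<integral>x. \<bar>v x\<bar> \<partial>?M)"
  define K where "K = 1 / g 1 + measure lebesgue ?\<Omega>"
  \<comment> \<open>The excess of the absolute value of \<open>u\<close> over \<open>A\<close>. The
    claim is that it vanishes almost everywhere, which follows once its integral is zero.\<close>
  define P where "P x = max 0 (\<bar>u x\<bar> - A)" for x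
  have fin: "?\<Omega> \<in> lmeasurable" by simp
  interpret finite_measure ?M using fin by (rule finite_measure_lebesgue_on)
  have L: "measure ?M (space ?M) = b - a" using ab by (simp add: measure_restrict_space)
  have g1: "0 < g 1" using Y unfolding young_function_def by simp
  have K: "0 < K" using g1 by (simp add: K_def add_pos_nonneg)
  have u_orl: "u \<in> orlicz_space ?\<Omega> G" and v_orl: "v \<in> orlicz_space ?\<Omega> G"
    using u by (auto simp: sobolev_space_0_def sobolev_space_def v_def)
  have ui: "integrable ?M u" and vi: "integrable ?M v"
    using orlicz_space_integrable_self[OF Y fin] u_orl v_orl by auto
  have Pi: "integrable ?M P" unfolding P_def using ui by (intro integrable_max) auto
  have small: "(\<integral>x. P x \<partial>?M) \<le> \<epsilon> * (K * (b - a) + K)" if "0 < \<epsilon>" for \<epsilon>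
  proof -
    obtain \<phi> where \<phi>: "\<phi> \<in> test_functions ?\<Omega>"
      and sum: "luxemburg_norm ?\<Omega> G (\<lambda>x. u x - \<phi> x) + luxemburg_norm ?\<Omega> G (\<lambda>x. v x - deriv \<phi> x) < \<epsilon>"
      using u \<open>0 < \<epsilon>\<close> unfolding sobolev_space_0_def v_def by blast
    obtain B where B: "\<And>x. x \<in> ?\<Omega> \<Longrightarrow> \<bar>\<phi> x\<bar> \<le> B"
      using continuous_on_bounded_interval[OF test_function_continuous_on[OF \<phi>]] by blast
    obtain B' where B': "\<And>x. x \<in> ?\<Omega> \<Longrightarrow> \<bar>deriv \<phi> x\<bar> \<le> B'"
      using continuous_on_bounded_interval[OF test_function_deriv_continuous_on[OF \<phi>]] by blast
    have o1: "(\<lambda>x. u x - \<phi> x) \<in> orlicz_space ?\<Omega> G"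
      using test_function_continuous_on[OF \<phi>]
      by (intro orlicz_space_diff_bounded[OF Y D fin u_orl _ B]
          continuous_on_measurable_lebesgue_on) auto
    have o2: "(\<lambda>x. v x - deriv \<phi> x) \<in> orlicz_space ?\<Omega> G"
      using test_function_deriv_continuous_on[OF \<phi>]
      by (intro orlicz_space_diff_bounded[OF Y D fin v_orl _ B']
          continuous_on_measurable_lebesgue_on) auto
    have e1: "(\<integral>x. \<bar>u x - \<phi> x\<bar> \<partial>?M) \<le> \<epsilon> * K" and e2: "(\<integral>x. \<bar>v x - deriv \<phi> x\<bar> \<partial>?M) \<le> \<epsilon> * K"
      unfolding K_def
      using sum luxemburg_norm_nonneg[OF Y o1] luxemburg_norm_nonneg[OF Y o2]
        integral_abs_le_luxemburg_norm[OF Y fin o1, of \<epsilon>]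
        integral_abs_le_luxemburg_norm[OF Y fin o2, of \<epsilon>]
      by linarith+
    have i1: "integrable ?M (\<lambda>x. \<bar>u x - \<phi> x\<bar>)" and i2: "integrable ?M (\<lambda>x. \<bar>v x - deriv \<phi> x\<bar>)"
      using orlicz_space_integrable_self[OF Y fin] o1 o2 by auto
    \<comment> \<open>The function simplifies to \<open>deriv \<phi>\<close>, which is thereby
      integrable; its L^1 norm exceeds \<open>A\<close> by at most the approximation error.\<close>
    have "integrable ?M (\<lambda>x. v x - (v x - deriv \<phi> x))"
      using vi orlicz_space_integrable_self[OF Y fin o2] by (rule Bochner_Integration.integrable_diff)
    then have "(\<integral>x. \<bar>deriv \<phi> x\<bar> \<partial>?M) \<le> (\<integral>x. \<bar>v x\<bar> + \<bar>v x - deriv \<phi> x\<bar> \<partial>?M)"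
      using vi i2 by (intro integral_mono) auto
    also have "\<dots> \<le> A + \<epsilon> * K" using vi i2 e2 by (simp add: A_def)
    finally have "\<bar>\<phi> x\<bar> \<le> A + \<epsilon> * K" if "x \<in> ?\<Omega>" for x
      using test_function_abs_le_integral_deriv[OF \<phi> that] by linarith
    moreover have "0 \<le> \<epsilon> * K" using K \<open>0 < \<epsilon>\<close> by simp
    \<comment> \<open>Triangle inequality through \<phi>, whose absolute value is at most
      \<open>A + \<epsilon> * K\<close>; the case \<open>P x = 0\<close> uses that the right side is
      nonnegative.\<close>
    ultimately have "P x \<le> \<epsilon> * K + \<bar>u x - \<phi> x\<bar>" if "x \<in> ?\<Omega>" for x
      using that by (force simp: P_def)
    then have "(\<integral>x. P x \<partial>?M) \<le> (\<integral>x. \<epsilon> * K + \<bar>u x - \<phi> x\<bar> \<partial>?M)"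
      using Pi i1 by (intro integral_mono) auto
    also have "\<dots> \<le> \<epsilon> * K * (b - a) + \<epsilon> * K" using i1 e1 L by simp
    finally show ?thesis by (simp add: algebra_simps)
  qed
  have "(\<integral>x. P x \<partial>?M) \<le> 0"
  proof (rule field_le_epsilon)
    fix e :: real assume "0 < e"
    \<comment> \<open>The factor of \<epsilon> in \<open>small\<close>, so \<epsilon>
      \<open>= e / Q\<close> produces exactly \<open>e\<close>.\<close>
    define Q where "Q = K * (b - a) + K"
    have "0 < Q" using K ab by (simp add: Q_def add_pos_pos)
    then show "(\<integral>x. P x \<partial>?M) \<le> 0 + e" using small[of "e / Q"] \<open>0 < e\<close> by (simp add: Q_def[symmetric])
  qed
  moreover have P0: "0 \<le> P x" for x by (simp add: P_def)
  ultimately have "(\<integral>x. P x \<partial>?M) = 0" by (intro antisym Bochner_Integration.integral_nonneg)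
  then have "AE x in ?M. P x = 0"
    using integral_nonneg_eq_0_iff_AE[OF Pi] P0 by simp
  then show ?thesis
    unfolding v_def[symmetric] A_def[symmetric]
    by eventually_elim (simp add: P_def max_def split: if_splits)
qed

section \<open>The lower bound\<close>

text \<open>In the energy constraint, \<open>H\<close> of the absolute value of \<open>u\<close> is
  replaced by its upper bound \<open>H A\<close>, which then leaves the integral.\<close>

lemma one_le_young_times_weight:
  assumes Y: "young_function H h" and fin: "\<Omega> \<in> lmeasurable"
    and wm: "w \<in> borel_measurable (lebesgue_on \<Omega>)" and wb: "AE x in lebesgue_on \<Omega>. \<bar>w x\<bar> \<le> M"
    and bound: "AE x in lebesgue_on \<Omega>. \<bar>u x\<bar> \<le> A"
    and one: "(\<integral>x. w x * H \<bar>u x\<bar> \<partial>lebesgue_on \<Omega>) = 1"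
  shows "1 \<le> H A * (\<integral>x. \<bar>w x\<bar> \<partial>lebesgue_on \<Omega>)"
proof -
  interpret finite_measure "lebesgue_on \<Omega>" using fin by (rule finite_measure_lebesgue_on)
  have wi: "integrable (lebesgue_on \<Omega>) w"
    using wb wm by (intro integrable_const_bound[where B = M]) auto
  \<comment> \<open>A non-integrable function would have integral \<open>0\<close> by convention,
    contradicting the value \<open>1\<close>.\<close>
  have i: "integrable (lebesgue_on \<Omega>) (\<lambda>x. w x * H \<bar>u x\<bar>)"
    using one not_integrable_integral_eq by fastforce
  have "(\<integral>x. w x * H \<bar>u x\<bar> \<partial>lebesgue_on \<Omega>) \<le> (\<integral>x. H A * \<bar>w x\<bar> \<partial>lebesgue_on \<Omega>)"
  proof (rule integral_mono_AE[OF i])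
    show "AE x in lebesgue_on \<Omega>. w x * H \<bar>u x\<bar> \<le> H A * \<bar>w x\<bar>"
      using bound
    proof eventually_elim
      case (elim x)
      have "w x * H \<bar>u x\<bar> \<le> \<bar>w x\<bar> * H A"
        using young_function_mono[OF Y _ elim] young_function_nonneg[OF Y, of "\<bar>u x\<bar>"]
        by (intro mult_mono) auto
      then show ?case by (simp add: mult.commute)
    qed
  qed (use wi in auto)
  then show ?thesis using one by simp
qed

theorem theorem5p1:
  fixes a b C c pm pp :: real
    and G g H h w :: "real \<Rightarrow> real"
    and \<Omega> :: "real set"
  defines "\<Omega> \<equiv> {a<..<b}"
  assumes ab: "a < b"
    and p: "1 \<le> pm" "pm \<le> pp"
    and G: "regular_young_function pm pp G g"
    and H: "regular_young_function pm pp H h"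
    and C: "1 \<le> C" "delta_prime C G" "delta_prime C H"
    and c: "inverse_delta_prime c G" "inverse_delta_prime c H"
    and w_meas: "w \<in> borel_measurable (lebesgue_on \<Omega>)"
    and w_bounded: "\<exists>M. AE x in lebesgue_on \<Omega>. \<bar>w x\<bar> \<le> M"
    and w_nonneg: "AE x in lebesgue_on \<Omega>. 0 \<le> w x"
    and w_nonzero: "\<not> (AE x in lebesgue_on \<Omega>. w x = 0)"
  shows "ereal (inverse (G (2 * c * (C powr pp) * (b - a) *
           (young_inv G (1 / (b - a)) /
            young_inv H (inverse (\<integral>x. \<bar>w x\<bar> \<partial>lebesgue_on \<Omega>))))))
         \<le> first_eigenvalue \<Omega> G H w 1"
proof -
  let ?M = "lebesgue_on \<Omega>"
  define L where "L = b - a"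
  define W where "W = (\<integral>x. \<bar>w x\<bar> \<partial>?M)"
  define k where "k = young_inv G (1 / L)"
  define q where "q = young_inv H (inverse W)"
  have YG: "young_function G g" and YH: "young_function H h"
    using G H unfolding regular_young_function_def by auto
  have L: "0 < L" using ab by (simp add: L_def)
  have fin: "\<Omega> \<in> lmeasurable" and meas: "measure lebesgue \<Omega> = L"
    using ab by (auto simp: \<Omega>_def L_def)
  obtain B where B: "AE x in ?M. \<bar>w x\<bar> \<le> B" using w_bounded by blast
  have "inverse (G (2 * c * (C powr pp) * L * (k / q)))
      \<le> (\<integral>x. G \<bar>weak_deriv \<Omega> u x\<bar> \<partial>?M) / (\<integral>x. w x * H \<bar>u x\<bar> \<partial>?M)"
    if u: "u \<in> admissible \<Omega> G H w 1" for u
  proof -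
    define v where "v = weak_deriv \<Omega> u"
    define A where "A = (\<integral>x. \<bar>v x\<bar> \<partial>?M)"
    define E where "E = (\<integral>x. G \<bar>v x\<bar> \<partial>?M)"
    define s where "s = young_inv G (1 / E)"
    have one: "(\<integral>x. w x * H \<bar>u x\<bar> \<partial>?M) = 1" and u0: "u \<in> sobolev_space_0 \<Omega> G"
      using u by (auto simp: admissible_def)
    have v: "v \<in> orlicz_space \<Omega> G"
      using u0 by (auto simp: v_def sobolev_space_0_def sobolev_space_def)
    have A0: "0 \<le> A" by (simp add: A_def)
    have "AE x in ?M. \<bar>u x\<bar> \<le> A"
      using sobolev_space_0_AE_bound[OF YG C(2) ab] u0 unfolding A_def v_def \<Omega>_def by blast
    then have HA: "1 \<le> H A * W"
      using one_le_young_times_weight[OF YH fin w_meas B _ one] by (simp add: W_def)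
    have "0 \<le> W" by (simp add: W_def)
    then have W: "0 < W" using HA by (cases "W = 0") auto
    have q: "0 < q" unfolding q_def using W by (intro young_inv_pos[OF YH]) simp
    have "H q = inverse W" unfolding q_def using W by (intro young_inv_right[OF YH]) simp
    also have "\<dots> \<le> H A" using HA W by (simp add: field_simps)
    finally have "H q \<le> H A" .
    \<comment> \<open>If \<open>A < q\<close>, strict monotonicity would give
      \<open>H A < H q\<close>. In particular \<open>A\<close> is positive, which makes
      \<open>E\<close> positive and \<open>1 / E\<close> meaningful.\<close>
    then have qA: "q \<le> A" using young_function_strict_mono[OF YH A0, of q] by linarith
    then have A: "0 < A" using q by simp
    have LE: "L * G (A / L) \<le> E"
      using jensen_young_function[OF YG fin _ v] L by (simp add: meas A_def E_def)
    then have E: "0 < E" using young_function_pos[OF YG, of "A / L"] A L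
      by (meson divide_pos_pos less_le_trans mult_pos_pos)
    \<comment> \<open>Jensen's inequality divided by \<open>L\<close> and read through the inverse
      of \<open>G\<close>.\<close>
    have AL: "A / L \<le> young_inv G (E / L)"
      using LE E L A by (subst le_young_inv_iff[OF YG]) (auto simp: field_simps)
    have s: "0 < s" unfolding s_def using E by (intro young_inv_pos[OF YG]) simp
    have k: "0 < k" unfolding k_def using L by (intro young_inv_pos[OF YG]) simp
    have "s * (q / L) \<le> s * young_inv G (E / L)"
      using AL qA s L by (intro mult_left_mono order_trans[OF _ AL] divide_right_mono) auto
    \<comment> \<open>The two arguments \<open>1 / E\<close> and \<open>E / L\<close> have product
      \<open>1 / L\<close>, so the energy cancels on the right and \<open>k\<close> appears.\<close>
    also have "\<dots> \<le> c * k"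
      using c(1)[unfolded inverse_delta_prime_def, rule_format, of "1 / E" "E / L"] E L
      by (simp add: s_def k_def)
    finally have "s * (q / L) \<le> c * k" .
    then have sc: "s \<le> c * L * (k / q)" using L q by (simp add: field_simps)
    \<comment> \<open>The factor \<open>2 * C powr pp\<close> is at least \<open>1\<close>, so
      inserting it only enlarges the argument of \<open>G\<close>, whose nonnegativity is read off
      from \<open>s > 0\<close>.\<close>
    have "1 \<le> C powr pp" using C(1) p by (intro ge_one_powr_ge_zero) auto
    moreover have "0 \<le> c * L * (k / q)" using sc s by linarith
    ultimately have "1 * (c * L * (k / q)) \<le> (2 * C powr pp) * (c * L * (k / q))"
      by (intro mult_right_mono) auto
    then have sX: "s \<le> 2 * c * (C powr pp) * L * (k / q)" using sc by (simp add: mult_ac)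
    have "1 / E = G s" unfolding s_def using E by (simp add: young_inv_right[OF YG])
    also have "\<dots> \<le> G (2 * c * (C powr pp) * L * (k / q))"
      using sX s by (intro young_function_mono[OF YG]) auto
    \<comment> \<open>Inversion reverses the order because \<open>1 / E\<close> is positive. The
      right side is \<open>E\<close>, which is the Rayleigh quotient of \<open>u\<close> since the
      constraint makes its denominator \<open>1\<close>.\<close>
    finally have "inverse (G (2 * c * (C powr pp) * L * (k / q))) \<le> inverse (1 / E)"
      using E by (intro le_imp_inverse_le) auto
    then show ?thesis by (simp add: one E_def v_def)
  qed
  then show ?thesis
    unfolding first_eigenvalue_def k_def q_def W_def L_def by (intro INF_greatest) simp
qed

end
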